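(* Let $\tau\in\mathbb{C}$ with $\operatorname{Im}\tau>0$, let $L\ge2$ be an integer with $\frac1{L+1}\notin\mathbb{Z}+\tau\mathbb{Z}$, and let $[z]=\theta\big(z/(L+1),\tau\big)/\big(\theta'(0,\tau)/(L+1)\big)$, where $\theta(z,\tau)=-\sum_{n\in\mathbb{Z}}e^{i\pi(n+\frac12)^2\tau+2\pi i(n+\frac12)(z+\frac12)}$ and $\theta'$ is the derivative in $z$. The operators, for $a\in\mathbb{Z}+b$, $$T^{\mathrm{ell}}_A(a)=\frac{\sqrt{[a-1][a+1]}}{[a]}E_{21}\otimes E_{12}+\frac{\sqrt{[a+1][a-1]}}{[a]}E_{12}\otimes E_{21}+\frac{[a+1]}{[a]}E_{11}\otimes E_{22}+\frac{[a-1]}{[a]}E_{22}\otimes E_{11}$$ form a local dynamical Temperley--Lieb operator on $V^{\pi_A^{\mathrm{unres}}}$ associated with the map $$\bar\kappa^{\mathrm{ell}}(a)=\frac{[a+1]+[a-1]}{[a]}.$$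
   Context: Fix a generic $b\in\mathbb{C}$ (so that $[a]\ne0$ and $\bar\kappa^{\mathrm{ell}}(a)\neq0$ for all $a\in\mathbb{Z}+b$). $\pi_A^{\mathrm{unres}}$ is the groupoid of the unoriented graph with vertex set $\mathbb{Z}+b$ and one edge between any two neighbouring numbers: its objects are the vertices, each edge gives two mutually inverse arrows, and all arrows are compositions of these. Write $(a,\pm1)$ for the arrow from $a$ to $a\pm1$. $V=V^{\pi_A^{\mathrm{unres}}}$ is the graded vector space with $V_{(a,-1)}=\mathbb{C}e_{(a,-1)}$, $V_{(a,+1)}=\mathbb{C}e_{(a,+1)}$ for all objects $a$, all other components zero. Tensor products: $(V\otimes W)_\gamma=\bigoplus_{\beta\circ\alpha=\gamma}V_\alpha\otimes W_\beta$ ($\beta\circ\alpha$ defined when $t(\alpha)=s(\beta)$, where $s,t$ denote source and target). For each $a$ the source fiber $\bigoplus_{\alpha\in s^{-1}(a)}(V\otimes V)_\alpha$ is identified with $\mathbb{C}^2\otimes\mathbb{C}^2$ by $e_{(a,\varepsilon_1)}\otimes e_{(a+\varepsilon_1,\varepsilon_2)}\mapsto e_{i_1}\otimes e_{i_2}$, with $i=1$ for $\varepsilon=+1$ and $i=2$ for $\varepsilon=-1$; $E_{ij}$ is the $2\times2$ matrix unit, $E_{ij}e_k=\delta_{jk}e_i$. The same square root is used in both off-diagonal entries. For a family $X(a)\in\bigoplus_{\alpha\in s^{-1}(a)}\mathrm{End}_{\mathbb{C}}((V\otimes V)_\alpha)$ and $u\otimes v\otimes w\in V_{\alpha_1}\otimes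 V_{\alpha_2}\otimes V_{\alpha_3}$ with composable arrows and $s(\alpha_1)=a$, set $X^{(12)}(a)(u\otimes v\otimes w)=X(a)(u\otimes v)\otimes w$ and $X^{(23)}(ah^{(1)})(u\otimes v\otimes w)=u\otimes X(t(\alpha_1))(v\otimes w)$. A local dynamical Temperley--Lieb operator on $V$ associated to $\bar\kappa:\mathrm{Ob}(\pi)\to\mathbb{C}\setminus\{0\}$ is a family $T(a)\in\bigoplus_{\alpha\in s^{-1}(a)}\mathrm{End}_{\mathbb{C}}((V\otimes V)_\alpha)$ such that for all $a$: $T(a)T(a)=\bar\kappa(a)T(a)$; $T^{(12)}(a)T^{(23)}(ah^{(1)})T^{(12)}(a)=T^{(12)}(a)$; $T^{(23)}(ah^{(1)})T^{(12)}(a)T^{(23)}(ah^{(1)})=T^{(23)}(ah^{(1)})$. *)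

theory Defs
  imports "HOL-Analysis.Analysis" "HOL-Library.Poly_Mapping"
begin

section \<open>Groupoids and the groupoid of an unoriented graph\<close>

record ('o, 'a) groupoid_data =
  Ob :: "'o set"
  Ar :: "'a set"
  src :: "'a \<Rightarrow> 'o"
  tgt :: "'a \<Rightarrow> 'o"
  idn :: "'o \<Rightarrow> 'a"
  cmp :: "'a \<Rightarrow> 'a \<Rightarrow> 'a"

text \<open>\<open>cmp G \<beta> \<alpha>\<close> is \<open>\<beta> \<circ> \<alpha>\<close> (first \<open>\<alpha>\<close>, then \<open>\<beta>\<close>); it is meaningful only if
  \<open>tgt G \<alpha> = src G \<beta>\<close>.\<close>

definition is_groupoid :: "('o, 'a) groupoid_data \<Rightarrow> bool" where
  "is_groupoid G \<longleftrightarrow>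
     (\<forall>\<alpha>\<in>Ar G. src G \<alpha> \<in> Ob G \<and> tgt G \<alpha> \<in> Ob G) \<and>
     (\<forall>a\<in>Ob G. idn G a \<in> Ar G \<and> src G (idn G a) = a \<and> tgt G (idn G a) = a) \<and>
     (\<forall>\<alpha>\<in>Ar G. \<forall>\<beta>\<in>Ar G. tgt G \<alpha> = src G \<beta> \<longrightarrow>
        cmp G \<beta> \<alpha> \<in> Ar G \<and> src G (cmp G \<beta> \<alpha>) = src G \<alpha> \<and> tgt G (cmp G \<beta> \<alpha>) = tgt G \<beta>) \<and>
     (\<forall>\<alpha>\<in>Ar G. \<forall>\<beta>\<in>Ar G. \<forall>\<gamma>\<in>Ar G. tgt G \<alpha> = src G \<beta> \<and> tgt G \<beta> = src G \<gamma> \<longrightarrow>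
        cmp G \<gamma> (cmp G \<beta> \<alpha>) = cmp G (cmp G \<gamma> \<beta>) \<alpha>) \<and>
     (\<forall>\<alpha>\<in>Ar G. cmp G \<alpha> (idn G (src G \<alpha>)) = \<alpha> \<and> cmp G (idn G (tgt G \<alpha>)) \<alpha> = \<alpha>) \<and>
     (\<forall>\<alpha>\<in>Ar G. \<exists>\<beta>\<in>Ar G. src G \<beta> = tgt G \<alpha> \<and> tgt G \<beta> = src G \<alpha> \<and>
        cmp G \<beta> \<alpha> = idn G (src G \<alpha>) \<and> cmp G \<alpha> \<beta> = idn G (tgt G \<alpha>))"

text \<open>A graph is given by its vertex set \<open>V\<close> and its set \<open>E\<close> of edges \<open>{x, y}\<close>.  Arrows of its
  groupoid are walks (nonempty vertex lists) modulo the equivalence relation generated by cancelling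
  a backtrack \<open>x, y, x\<close> to \<open>x\<close>; thus each edge contributes two mutually inverse arrows, and these
  generate freely.\<close>

definition walks :: "'v set \<Rightarrow> 'v set set \<Rightarrow> 'v list set" where
  "walks V E = {p. p \<noteq> [] \<and> set p \<subseteq> V \<and> successively (\<lambda>x y. {x, y} \<in> E) p}"

definition backtrack :: "'v set \<Rightarrow> 'v set set \<Rightarrow> ('v list \<times> 'v list) set" where
  "backtrack V E = {(p, q). p \<in> walks V E \<and> q \<in> walks V E \<and>
     (\<exists>xs x y ys. p = xs @ [x, y, x] @ ys \<and> q = xs @ [x] @ ys)}"

definition walk_equiv :: "'v set \<Rightarrow> 'v set set \<Rightarrow> ('v list \<times> 'v list) set" where
  "walk_equiv V E = (backtrack V E \<union> (backtrack V E)\<inverse>)\<^sup>* \<inter> (walks V E \<times> walks V E)"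

definition walk_class :: "'v set \<Rightarrow> 'v set set \<Rightarrow> 'v list \<Rightarrow> 'v list set" where
  "walk_class V E p = walk_equiv V E `` {p}"

definition graph_groupoid :: "'v set \<Rightarrow> 'v set set \<Rightarrow> ('v, 'v list set) groupoid_data" where
  "graph_groupoid V E =
     \<lparr>Ob = V,
      Ar = walks V E // walk_equiv V E,
      src = (\<lambda>A. hd (SOME p. p \<in> A)),
      tgt = (\<lambda>A. last (SOME p. p \<in> A)),
      idn = (\<lambda>a. walk_class V E [a]),
      cmp = (\<lambda>B A. walk_equiv V E `` {p @ tl q |p q. p \<in> A \<and> q \<in> B})\<rparr>"

lemma equiv_walk_equiv: "equiv (walks V E) (walk_equiv V E)"
proof (rule equivI)
  have "sym ((backtrack V E \<union> (backtrack V E)\<inverse>)\<^sup>*)"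
    by (intro sym_rtrancl) (auto simp: sym_def)
  then show "sym (walk_equiv V E)"
    by (auto simp: walk_equiv_def sym_def)
  show "trans (walk_equiv V E)"
    by (auto simp: walk_equiv_def trans_def)
qed (auto simp: walk_equiv_def refl_on_def)

lemma walk_equiv_ends:
  assumes "(p, q) \<in> walk_equiv V E"
  shows "hd p = hd q" "last p = last q"
proof -
  have "(p, q) \<in> (backtrack V E \<union> (backtrack V E)\<inverse>)\<^sup>*"
    using assms by (simp add: walk_equiv_def)
  then have "hd p = hd q \<and> last p = last q"
    by (induction rule: rtrancl_induct) (auto simp: backtrack_def hd_append last_append)
  then show "hd p = hd q" "last p = last q" by auto
qed

lemma walk_append:
  assumes "p \<in> walks V E" "q \<in> walks V E" "last p = hd q"
  shows "p @ tl q \<in> walks V E"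
  using assms by (cases q) (auto simp: walks_def successively_append_iff successively_Cons)

lemma append_tl_eq: "p \<noteq> [] \<Longrightarrow> q \<noteq> [] \<Longrightarrow> last p = hd q \<Longrightarrow> p @ tl q = butlast p @ q"
  by (metis append_Cons append_Nil append_assoc append_butlast_last_id list.collapse)

lemma walks_nonempty: "p \<in> walks V E \<Longrightarrow> p \<noteq> []"
  by (simp add: walks_def)

lemma walk_equiv_cong_left:
  assumes "(p, p') \<in> walk_equiv V E" "q \<in> walks V E" "last p = hd q"
  shows "(p @ tl q, p' @ tl q) \<in> walk_equiv V E"
proof -
  let ?R = "backtrack V E \<union> (backtrack V E)\<inverse>"
  have W: "p \<in> walks V E" "p' \<in> walks V E" and R: "(p, p') \<in> ?R\<^sup>*"
    using assms by (auto simp: walk_equiv_def)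
  have B: "(r @ tl q, r' @ tl q) \<in> backtrack V E"
    if rr: "(r, r') \<in> backtrack V E" and "last r = hd q" for r r'
  proof -
    obtain xs x y ys where s: "r = xs @ [x, y, x] @ ys" "r' = xs @ [x] @ ys"
      and w: "r \<in> walks V E" "r' \<in> walks V E"
      using rr unfolding backtrack_def by blast
    have "last r' = hd q" using that(2) s by (auto simp: last_append)
    then have ww: "r @ tl q \<in> walks V E" "r' @ tl q \<in> walks V E"
      using w that(2) assms(2) by (auto intro: walk_append)
    have "r @ tl q = xs @ [x, y, x] @ (ys @ tl q)" "r' @ tl q = xs @ [x] @ (ys @ tl q)"
      using s by auto
    with ww show ?thesis unfolding backtrack_def by blast
  qed
  have "(p @ tl q, p' @ tl q) \<in> ?R\<^sup>* \<and> last p' = hd q"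
    using R
  proof (induction rule: rtrancl_induct)
    case base
    then show ?case using assms(3) by simp
  next
    case (step r r')
    have l: "last r' = last r"
      using step(2) by (auto simp: backtrack_def last_append)
    then have "(r @ tl q, r' @ tl q) \<in> ?R"
      using step B by auto
    then show ?case using step l by (auto intro: rtrancl_into_rtrancl)
  qed
  then show ?thesis
    using W assms walk_equiv_ends[OF assms(1)]
    by (auto simp: walk_equiv_def intro: walk_append)
qed

lemma walk_equiv_cong_right:
  assumes "(q, q') \<in> walk_equiv V E" "p \<in> walks V E" "last p = hd q"
  shows "(p @ tl q, p @ tl q') \<in> walk_equiv V E"
proof -
  let ?R = "backtrack V E \<union> (backtrack V E)\<inverse>"
  have W: "q \<in> walks V E" "q' \<in> walks V E" and R: "(q, q') \<in> ?R\<^sup>*"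
    using assms by (auto simp: walk_equiv_def)
  have B: "(p @ tl r, p @ tl r') \<in> backtrack V E"
    if rr: "(r, r') \<in> backtrack V E" and "last p = hd r" for r r'
  proof -
    obtain xs x y ys where s: "r = xs @ [x, y, x] @ ys" "r' = xs @ [x] @ ys"
      and w: "r \<in> walks V E" "r' \<in> walks V E"
      using rr unfolding backtrack_def by blast
    have h: "last p = hd r'" using that(2) s by (auto simp: hd_append)
    then have ww: "p @ tl r \<in> walks V E" "p @ tl r' \<in> walks V E"
      using w that(2) assms(2) by (auto intro: walk_append)
    have "p @ tl r = (butlast p @ xs) @ [x, y, x] @ ys"
      using s append_tl_eq[of p r] that(2) w assms(2) walks_nonempty by fastforce
    moreover have "p @ tl r' = (butlast p @ xs) @ [x] @ ys"
      using s append_tl_eq[of p r'] h w assms(2) walks_nonempty by fastforce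
    ultimately show ?thesis using ww unfolding backtrack_def by blast
  qed
  have "(p @ tl q, p @ tl q') \<in> ?R\<^sup>* \<and> last p = hd q'"
    using R
  proof (induction rule: rtrancl_induct)
    case base
    then show ?case using assms(3) by simp
  next
    case (step r r')
    have l: "hd r' = hd r"
      using step(2) by (auto simp: backtrack_def hd_append)
    then have "(p @ tl r, p @ tl r') \<in> ?R"
      using step B by auto
    then show ?case using step l by (auto intro: rtrancl_into_rtrancl)
  qed
  then show ?thesis
    using W assms walk_equiv_ends[OF assms(1)]
    by (auto simp: walk_equiv_def intro: walk_append)
qed

lemma walk_class_eq_iff:
  "p \<in> walks V E \<Longrightarrow> q \<in> walks V E \<Longrightarrow>
     walk_class V E p = walk_class V E q \<longleftrightarrow> (p, q) \<in> walk_equiv V E"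
  unfolding walk_class_def by (rule eq_equiv_class_iff[OF equiv_walk_equiv])

lemma walk_class_in_Ar: "p \<in> walks V E \<Longrightarrow> walk_class V E p \<in> Ar (graph_groupoid V E)"
  by (simp add: graph_groupoid_def walk_class_def quotientI)

lemma Ar_graph_groupoidE:
  assumes "A \<in> Ar (graph_groupoid V E)"
  obtains p where "p \<in> walks V E" "A = walk_class V E p"
  using assms by (auto simp: graph_groupoid_def walk_class_def elim: quotientE)

lemma some_in_walk_class:
  assumes "p \<in> walks V E"
  shows "(p, SOME q. q \<in> walk_class V E p) \<in> walk_equiv V E"
proof -
  have "p \<in> walk_class V E p"
    unfolding walk_class_def by (rule equiv_class_self[OF equiv_walk_equiv assms])
  then have "(SOME q. q \<in> walk_class V E p) \<in> walk_class V E p"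
    by (rule someI)
  then show ?thesis by (simp add: walk_class_def)
qed

lemma src_walk_class: "p \<in> walks V E \<Longrightarrow> src (graph_groupoid V E) (walk_class V E p) = hd p"
  and tgt_walk_class: "p \<in> walks V E \<Longrightarrow> tgt (graph_groupoid V E) (walk_class V E p) = last p"
  using walk_equiv_ends[OF some_in_walk_class, symmetric] by (simp_all add: graph_groupoid_def)

lemma cmp_walk_class:
  assumes "p \<in> walks V E" "q \<in> walks V E" "last p = hd q"
  shows "cmp (graph_groupoid V E) (walk_class V E q) (walk_class V E p) = walk_class V E (p @ tl q)"
proof -
  let ?S = "{p' @ tl q' |p' q'. p' \<in> walk_class V E p \<and> q' \<in> walk_class V E q}"
  have refl: "(p, p) \<in> walk_equiv V E" "(q, q) \<in> walk_equiv V E"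
    using assms equiv_walk_equiv by (auto simp: walk_equiv_def)
  have 1: "(p @ tl q, r) \<in> walk_equiv V E" if rS: "r \<in> ?S" for r
  proof -
    obtain p' q' where r: "r = p' @ tl q'"
      and e: "(p, p') \<in> walk_equiv V E" "(q, q') \<in> walk_equiv V E"
      using rS by (auto simp: walk_class_def)
    have "p' \<in> walks V E" using e by (auto simp: walk_equiv_def)
    moreover have "last p' = hd q" using walk_equiv_ends[OF e(1)] assms by simp
    ultimately have "(p' @ tl q, p' @ tl q') \<in> walk_equiv V E"
      using walk_equiv_cong_right e by blast
    moreover have "(p @ tl q, p' @ tl q) \<in> walk_equiv V E"
      using walk_equiv_cong_left e assms by blast
    ultimately show ?thesis
      using equivE[OF equiv_walk_equiv] r by (meson transE)
  qed
  have 2: "p @ tl q \<in> ?S" using refl by (auto simp: walk_class_def)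
  have "walk_equiv V E `` ?S = walk_equiv V E `` {p @ tl q}"
  proof
    show "walk_equiv V E `` ?S \<subseteq> walk_equiv V E `` {p @ tl q}"
    proof
      fix x assume "x \<in> walk_equiv V E `` ?S"
      then obtain r where "r \<in> ?S" "(r, x) \<in> walk_equiv V E" by blast
      with 1[of r] have "(p @ tl q, x) \<in> walk_equiv V E"
        using equivE[OF equiv_walk_equiv] by (meson transE)
      then show "x \<in> walk_equiv V E `` {p @ tl q}" by simp
    qed
    show "walk_equiv V E `` {p @ tl q} \<subseteq> walk_equiv V E `` ?S"
      using 2 by blast
  qed
  then show ?thesis by (simp add: graph_groupoid_def walk_class_def)
qed

lemma rev_walk:
  assumes "p \<in> walks V E"
  shows "rev p \<in> walks V E"
proof -
  have "(\<lambda>x y. {y, x} \<in> E) = (\<lambda>x y. {x, y} \<in> E)"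
    by (simp add: insert_commute)
  moreover have "successively (\<lambda>x y. {y, x} \<in> E) (rev p)"
    using assms by (simp add: walks_def)
  ultimately have "successively (\<lambda>x y. {x, y} \<in> E) (rev p)"
    by argo
  then show ?thesis using assms by (simp only: walks_def mem_Collect_eq set_rev rev_is_Nil_conv) simp
qed

lemma walk_rev_cancel:
  assumes "p \<in> walks V E"
  shows "(p @ tl (rev p), [hd p]) \<in> walk_equiv V E"
  using assms
proof (induction p rule: rev_induct)
  case Nil
  then show ?case by (simp add: walks_def)
next
  case (snoc x p)
  show ?case
  proof (cases "p = []")
    case True
    then show ?thesis using snoc.prems by (simp add: walk_equiv_def)
  next
    case False
    then obtain p1 z where p: "p = p1 @ [z]" by (metis append_butlast_last_id)
    have w: "p \<in> walks V E"
      using snoc.prems False by (simp add: walks_def successively_append_iff)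
    have "(p @ [x]) @ tl (rev (p @ [x])) \<in> walks V E"
      using snoc.prems by (intro walk_append rev_walk) (auto simp: hd_rev)
    moreover have "p @ tl (rev p) \<in> walks V E"
      using w by (intro walk_append rev_walk) (auto simp: hd_rev)
    moreover have "(p @ [x]) @ tl (rev (p @ [x])) = p1 @ [z, x, z] @ rev p1"
      "p @ tl (rev p) = p1 @ [z] @ rev p1"
      by (simp_all add: p)
    ultimately have "((p @ [x]) @ tl (rev (p @ [x])), p @ tl (rev p)) \<in> walk_equiv V E"
      unfolding walk_equiv_def backtrack_def by blast
    with snoc.IH[OF w] have "((p @ [x]) @ tl (rev (p @ [x])), [hd p]) \<in> walk_equiv V E"
      using equivE[OF equiv_walk_equiv] by (meson transE)
    then show ?thesis using False by (simp add: hd_append)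
  qed
qed

lemma is_groupoid_graph_groupoid: "is_groupoid (graph_groupoid V E)"
proof -
  let ?G = "graph_groupoid V E"
  note [simp] = src_walk_class tgt_walk_class
  have ends: "hd p \<in> V" "last p \<in> V" "p \<noteq> []" if "p \<in> walks V E" for p
    using that by (auto simp: walks_def)
  have sing: "[a] \<in> walks V E" if "a \<in> V" for a
    using that by (simp add: walks_def)
  have Ob: "Ob ?G = V" and idn: "idn ?G a = walk_class V E [a]" for a
    by (simp_all add: graph_groupoid_def)
  have f1: "src ?G \<alpha> \<in> Ob ?G \<and> tgt ?G \<alpha> \<in> Ob ?G" if "\<alpha> \<in> Ar ?G" for \<alpha>
    using that by (auto elim!: Ar_graph_groupoidE simp: Ob ends)
  have f2: "idn ?G a \<in> Ar ?G \<and> src ?G (idn ?G a) = a \<and> tgt ?G (idn ?G a) = a"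
    if "a \<in> Ob ?G" for a
    using that by (simp add: Ob idn sing walk_class_in_Ar)
  have f3: "cmp ?G \<beta> \<alpha> \<in> Ar ?G \<and> src ?G (cmp ?G \<beta> \<alpha>) = src ?G \<alpha> \<and>
      tgt ?G (cmp ?G \<beta> \<alpha>) = tgt ?G \<beta>"
    if ab: "\<alpha> \<in> Ar ?G" "\<beta> \<in> Ar ?G" "tgt ?G \<alpha> = src ?G \<beta>" for \<alpha> \<beta>
  proof -
    obtain p where p: "p \<in> walks V E" "\<alpha> = walk_class V E p" using ab Ar_graph_groupoidE by blast
    obtain q where q: "q \<in> walks V E" "\<beta> = walk_class V E q" using ab Ar_graph_groupoidE by blast
    have pq: "last p = hd q" using ab p q by simp
    have w: "p @ tl q \<in> walks V E" using p q pq walk_append by blast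
    moreover have "hd (p @ tl q) = hd p" using ends p by (simp add: hd_append)
    moreover have "last (p @ tl q) = last q"
      using append_tl_eq[of p q] ends p q pq by (metis last_appendR)
    ultimately show ?thesis using p q pq by (simp add: cmp_walk_class walk_class_in_Ar)
  qed
  have f4: "cmp ?G \<gamma> (cmp ?G \<beta> \<alpha>) = cmp ?G (cmp ?G \<gamma> \<beta>) \<alpha>"
    if ab: "\<alpha> \<in> Ar ?G" "\<beta> \<in> Ar ?G" "\<gamma> \<in> Ar ?G" "tgt ?G \<alpha> = src ?G \<beta>" "tgt ?G \<beta> = src ?G \<gamma>"
    for \<alpha> \<beta> \<gamma>
  proof -
    obtain p where p: "p \<in> walks V E" "\<alpha> = walk_class V E p" using ab Ar_graph_groupoidE by blast
    obtain q where q: "q \<in> walks V E" "\<beta> = walk_class V E q" using ab Ar_graph_groupoidE by blast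
    obtain r where r: "r \<in> walks V E" "\<gamma> = walk_class V E r" using ab Ar_graph_groupoidE by blast
    have pq: "last p = hd q" and qr: "last q = hd r" using ab p q r by auto
    have w: "p @ tl q \<in> walks V E" "q @ tl r \<in> walks V E" using p q r pq qr walk_append by blast+
    have l: "last (p @ tl q) = hd r"
      using append_tl_eq[of p q] ends p q pq qr by (metis last_appendR)
    have h: "last p = hd (q @ tl r)" using ends q pq by (simp add: hd_append)
    have "tl (q @ tl r) = tl q @ tl r" using ends q by simp
    then show ?thesis
      using p q r pq qr w l h by (simp add: cmp_walk_class)
  qed
  have f5: "cmp ?G \<alpha> (idn ?G (src ?G \<alpha>)) = \<alpha> \<and> cmp ?G (idn ?G (tgt ?G \<alpha>)) \<alpha> = \<alpha>"
    if al: "\<alpha> \<in> Ar ?G" for \<alpha>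
  proof -
    obtain p where p: "p \<in> walks V E" "\<alpha> = walk_class V E p"
      using al Ar_graph_groupoidE by blast
    then show ?thesis
      using ends[OF p(1)] sing by (simp add: idn cmp_walk_class)
  qed
  have f6: "\<exists>\<beta>\<in>Ar ?G. src ?G \<beta> = tgt ?G \<alpha> \<and> tgt ?G \<beta> = src ?G \<alpha> \<and>
      cmp ?G \<beta> \<alpha> = idn ?G (src ?G \<alpha>) \<and> cmp ?G \<alpha> \<beta> = idn ?G (tgt ?G \<alpha>)"
    if al: "\<alpha> \<in> Ar ?G" for \<alpha>
  proof -
    obtain p where p: "p \<in> walks V E" "\<alpha> = walk_class V E p"
      using al Ar_graph_groupoidE by blast
    note r = rev_walk[OF p(1)]
    have hl: "last p = hd (rev p)" "last (rev p) = hd p"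
      using ends[OF p(1)] by (simp_all add: hd_rev last_rev)
    have e: "(p @ tl (rev p), [hd p]) \<in> walk_equiv V E" "(rev p @ tl p, [last p]) \<in> walk_equiv V E"
      using walk_rev_cancel[OF p(1)] walk_rev_cancel[OF r] hl by auto
    have "walk_class V E (p @ tl (rev p)) = walk_class V E [hd p]"
      "walk_class V E (rev p @ tl p) = walk_class V E [last p]"
      using e by (auto simp: walk_class_eq_iff walk_equiv_def)
    then show ?thesis
      using p r hl by (intro bexI[of _ "walk_class V E (rev p)"])
        (simp_all add: cmp_walk_class walk_class_in_Ar idn)
  qed
  show ?thesis
    unfolding is_groupoid_def
    apply (intro conjI)
    subgoal using f1 by (intro ballI)
    subgoal using f2 by (intro ballI)
    subgoal using f3 by (intro ballI impI)
    subgoal by (intro ballI impI, elim conjE) (rule f4)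
    subgoal using f5 by (intro ballI)
    subgoal using f6 by (intro ballI)
    done
qed


section \<open>Graded vector spaces\<close>

text \<open>A complex vector space graded by the arrows of a groupoid, presented by a homogeneous basis: the
  underlying space is the span of the \<open>e\<^sub>i = Poly_Mapping.single i 1\<close> (\<open>i \<in> basis V\<close>) in the free
  complex vector space \<open>'i \<Rightarrow>\<^sub>0 complex\<close>, with \<open>e\<^sub>i\<close> in degree \<open>deg V i\<close>.\<close>

record ('i, 'a) graded_space =
  basis :: "'i set"
  deg :: "'i \<Rightarrow> 'a"

definition is_graded_space :: "('o, 'a) groupoid_data \<Rightarrow> ('i, 'a) graded_space \<Rightarrow> bool" where
  "is_graded_space G V \<longleftrightarrow> deg V ` basis V \<subseteq> Ar G"

definition component :: "('i, 'a) graded_space \<Rightarrow> 'a \<Rightarrow> ('i \<Rightarrow>\<^sub>0 complex) set" where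
  "component V \<gamma> = {p. Poly_Mapping.keys p \<subseteq> {i \<in> basis V. deg V i = \<gamma>}}"

text \<open>The sum of the components over all arrows with source \<open>a\<close>.\<close>

definition source_fiber ::
    "('o, 'a) groupoid_data \<Rightarrow> ('i, 'a) graded_space \<Rightarrow> 'o \<Rightarrow> ('i \<Rightarrow>\<^sub>0 complex) set" where
  "source_fiber G V a =
     {p. Poly_Mapping.keys p \<subseteq> {i \<in> basis V. deg V i \<in> Ar G \<and> src G (deg V i) = a}}"

text \<open>The label \<open>(i, j)\<close> stands for \<open>e\<^sub>i \<otimes> e\<^sub>j\<close>.  Only pairs of composable degree occur, so the
  component at \<open>\<gamma>\<close> is the sum of all \<open>V\<^sub>\<alpha> \<otimes> W\<^sub>\<beta>\<close> with \<open>\<beta> \<circ> \<alpha> = \<gamma>\<close>.\<close>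

definition tensor :: "('o, 'a) groupoid_data \<Rightarrow> ('i, 'a) graded_space \<Rightarrow> ('j, 'a) graded_space \<Rightarrow>
    ('i \<times> 'j, 'a) graded_space" where
  "tensor G V W =
     \<lparr>basis = {(i, j). i \<in> basis V \<and> j \<in> basis W \<and> tgt G (deg V i) = src G (deg W j)},
      deg = (\<lambda>(i, j). cmp G (deg W j) (deg V i))\<rparr>"

lemma is_graded_space_tensor:
  assumes "is_groupoid G" "is_graded_space G V" "is_graded_space G W"
  shows "is_graded_space G (tensor G V W)"
proof -
  have "cmp G \<beta> \<alpha> \<in> Ar G" if "\<alpha> \<in> Ar G" "\<beta> \<in> Ar G" "tgt G \<alpha> = src G \<beta>" for \<alpha> \<beta>
    using assms(1) that unfolding is_groupoid_def by blast
  moreover have "deg V i \<in> Ar G" if "i \<in> basis V" for i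
    using assms(2) that by (auto simp: is_graded_space_def)
  moreover have "deg W j \<in> Ar G" if "j \<in> basis W" for j
    using assms(3) that by (auto simp: is_graded_space_def)
  ultimately show ?thesis
    by (auto simp: is_graded_space_def tensor_def)
qed

definition cscale :: "complex \<Rightarrow> ('i \<Rightarrow>\<^sub>0 complex) \<Rightarrow> ('i \<Rightarrow>\<^sub>0 complex)" where
  "cscale c = Poly_Mapping.map ((*) c)"

definition linear_ext :: "('i \<Rightarrow> ('j \<Rightarrow>\<^sub>0 complex)) \<Rightarrow> ('i \<Rightarrow>\<^sub>0 complex) \<Rightarrow> ('j \<Rightarrow>\<^sub>0 complex)" where
  "linear_ext g p = (\<Sum>i\<in>Poly_Mapping.keys p. cscale (Poly_Mapping.lookup p i) (g i))"

text \<open>The elements of \<open>\<Oplus>\<^bsub>\<gamma> \<in> s\<^sup>-\<^sup>1(a)\<^esub> End(V\<^sub>\<gamma>)\<close>, as operators on the source fiber at \<open>a\<close> (their values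
  elsewhere are irrelevant).  The last clause expresses that the sum is a direct sum: only finitely
  many summands are nonzero.\<close>

definition fiber_End :: "('o, 'a) groupoid_data \<Rightarrow> ('i, 'a) graded_space \<Rightarrow> 'o \<Rightarrow>
    (('i \<Rightarrow>\<^sub>0 complex) \<Rightarrow> ('i \<Rightarrow>\<^sub>0 complex)) set" where
  "fiber_End G V a = {f.
     (\<forall>p\<in>source_fiber G V a. \<forall>q\<in>source_fiber G V a. f (p + q) = f p + f q) \<and>
     (\<forall>c. \<forall>p\<in>source_fiber G V a. f (cscale c p) = cscale c (f p)) \<and>
     (\<forall>\<gamma>\<in>Ar G. src G \<gamma> = a \<longrightarrow> f ` component V \<gamma> \<subseteq> component V \<gamma>) \<and>
     finite {\<gamma>\<in>Ar G. src G \<gamma> = a \<and> (\<exists>p\<in>component V \<gamma>. f p \<noteq> 0)}}"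


section \<open>Local dynamical Temperley--Lieb operators\<close>

text \<open>\<open>op12 X a (e\<^sub>i \<otimes> e\<^sub>j \<otimes> e\<^sub>k) = X(a) (e\<^sub>i \<otimes> e\<^sub>j) \<otimes> e\<^sub>k\<close> and
  \<open>op23 G V X (e\<^sub>i \<otimes> e\<^sub>j \<otimes> e\<^sub>k) = e\<^sub>i \<otimes> X(t(deg e\<^sub>i)) (e\<^sub>j \<otimes> e\<^sub>k)\<close>, extended linearly.  The restriction of
  \<open>op23 G V X\<close> to the source fiber at \<open>a\<close> is the operator written \<open>X\<^sup>(\<^sup>2\<^sup>3\<^sup>)(a h\<^sup>(\<^sup>1\<^sup>))\<close>.\<close>

definition op12 ::
    "('o \<Rightarrow> ('i \<times> 'i \<Rightarrow>\<^sub>0 complex) \<Rightarrow> ('i \<times> 'i \<Rightarrow>\<^sub>0 complex)) \<Rightarrow> 'o \<Rightarrow>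
     ('i \<times> 'i \<times> 'i \<Rightarrow>\<^sub>0 complex) \<Rightarrow> ('i \<times> 'i \<times> 'i \<Rightarrow>\<^sub>0 complex)" where
  "op12 X a = linear_ext (\<lambda>(i, j, k).
     linear_ext (\<lambda>(i', j'). Poly_Mapping.single (i', j', k) 1)
       (X a (Poly_Mapping.single (i, j) 1)))"

definition op23 :: "('o, 'a) groupoid_data \<Rightarrow> ('i, 'a) graded_space \<Rightarrow>
     ('o \<Rightarrow> ('i \<times> 'i \<Rightarrow>\<^sub>0 complex) \<Rightarrow> ('i \<times> 'i \<Rightarrow>\<^sub>0 complex)) \<Rightarrow>
     ('i \<times> 'i \<times> 'i \<Rightarrow>\<^sub>0 complex) \<Rightarrow> ('i \<times> 'i \<times> 'i \<Rightarrow>\<^sub>0 complex)" where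
  "op23 G V X = linear_ext (\<lambda>(i, j, k).
     linear_ext (\<lambda>(j', k'). Poly_Mapping.single (i, j', k') 1)
       (X (tgt G (deg V i)) (Poly_Mapping.single (j, k) 1)))"

definition local_dynamical_TL :: "('o, 'a) groupoid_data \<Rightarrow> ('i, 'a) graded_space \<Rightarrow> ('o \<Rightarrow> complex) \<Rightarrow>
     ('o \<Rightarrow> ('i \<times> 'i \<Rightarrow>\<^sub>0 complex) \<Rightarrow> ('i \<times> 'i \<Rightarrow>\<^sub>0 complex)) \<Rightarrow> bool" where
  "local_dynamical_TL G V \<kappa> T \<longleftrightarrow>
     (\<forall>a\<in>Ob G. \<kappa> a \<noteq> 0) \<and>
     (\<forall>a\<in>Ob G. T a \<in> fiber_End G (tensor G V V) a) \<and>
     (\<forall>a\<in>Ob G. \<forall>p\<in>source_fiber G (tensor G V V) a.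
        T a (T a p) = cscale (\<kappa> a) (T a p)) \<and>
     (\<forall>a\<in>Ob G. \<forall>p\<in>source_fiber G (tensor G V (tensor G V V)) a.
        op12 T a (op23 G V T (op12 T a p)) = op12 T a p \<and>
        op23 G V T (op12 T a (op23 G V T p)) = op23 G V T p)"


section \<open>The unrestricted type A groupoid and its graded vector space\<close>

definition shifted_ints :: "complex \<Rightarrow> complex set" where
  "shifted_ints b = {of_int n + b |n. True}"

definition piA_edges :: "complex \<Rightarrow> complex set set" where
  "piA_edges b = {{a, a + 1} |a. a \<in> shifted_ints b}"

definition piA :: "complex \<Rightarrow> (complex, complex list set) groupoid_data" where
  "piA b = graph_groupoid (shifted_ints b) (piA_edges b)"

text \<open>The arrow \<open>(a, \<epsilon>)\<close> from \<open>a\<close> to \<open>a + \<epsilon>\<close>, for \<open>\<epsilon> = \<plusminus>1\<close>.\<close>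

definition step_arrow :: "complex \<Rightarrow> complex \<times> int \<Rightarrow> complex list set" where
  "step_arrow b = (\<lambda>(a, \<epsilon>). walk_class (shifted_ints b) (piA_edges b) [a, a + of_int \<epsilon>])"

definition VA :: "complex \<Rightarrow> (complex \<times> int, complex list set) graded_space" where
  "VA b = \<lparr>basis = shifted_ints b \<times> {1, -1}, deg = step_arrow b\<rparr>"

lemma step_walk:
  assumes "a \<in> shifted_ints b" "\<epsilon> \<in> {1, -1}"
  shows "[a, a + of_int \<epsilon>] \<in> walks (shifted_ints b) (piA_edges b)"
proof -
  obtain n where n: "a = of_int n + b" using assms(1) by (auto simp: shifted_ints_def)
  have "a + of_int \<epsilon> = of_int (n + \<epsilon>) + b" by (simp add: n)
  then have m: "a + of_int \<epsilon> \<in> shifted_ints b" unfolding shifted_ints_def by blast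
  have "{a, a + of_int \<epsilon>} \<in> piA_edges b"
  proof (cases "\<epsilon> = 1")
    case True
    then show ?thesis using assms(1) by (auto simp: piA_edges_def)
  next
    case False
    then have "{a, a + of_int \<epsilon>} = {a - 1, (a - 1) + 1}" "a - 1 \<in> shifted_ints b"
      using assms(2) m by auto
    then show ?thesis unfolding piA_edges_def by blast
  qed
  then show ?thesis using assms(1) m by (simp add: walks_def)
qed

lemma step_arrow_ends:
  assumes "a \<in> shifted_ints b" "\<epsilon> \<in> {1, -1}"
  shows "src (piA b) (step_arrow b (a, \<epsilon>)) = a"
    and "tgt (piA b) (step_arrow b (a, \<epsilon>)) = a + of_int \<epsilon>"
  using step_walk[OF assms] by (simp_all add: piA_def step_arrow_def src_walk_class tgt_walk_class)

lemma is_graded_space_VA: "is_graded_space (piA b) (VA b)"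
proof -
  have "step_arrow b (a, \<epsilon>) \<in> Ar (piA b)" if "a \<in> shifted_ints b" "\<epsilon> \<in> {1, -1}" for a \<epsilon>
    using walk_class_in_Ar[OF step_walk[OF that]] by (simp add: piA_def step_arrow_def)
  then show ?thesis
    by (auto simp: is_graded_space_def VA_def)
qed

text \<open>The space \<open>\<complex>\<^sup>2 \<otimes> \<complex>\<^sup>2\<close> is \<open>complex^(2 \<times> 2)\<close>, with \<open>e\<^sub>i \<otimes> e\<^sub>j\<close> the unit vector of index \<open>(i, j)\<close>.\<close>

definition kron :: "complex^2^2 \<Rightarrow> complex^2^2 \<Rightarrow> complex^(2 \<times> 2)^(2 \<times> 2)" (infixl \<open>\<otimes>\<^sub>K\<close> 75) where
  "A \<otimes>\<^sub>K B = (\<chi> p q. A $ fst p $ fst q * B $ snd p $ snd q)"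

definition mscale :: "complex \<Rightarrow> complex^'n^'m \<Rightarrow> complex^'n^'m" (infixr \<open>*\<^sub>M\<close> 72) where
  "c *\<^sub>M A = (\<chi> i j. c * A $ i $ j)"

definition matrix_unit :: "2 \<Rightarrow> 2 \<Rightarrow> complex^2^2" where
  "matrix_unit i j = (\<chi> k l. if k = i \<and> l = j then 1 else 0)"

definition sign_of :: "2 \<Rightarrow> int" where
  "sign_of i = (if i = 1 then 1 else -1)"

text \<open>\<open>fiber_coords a\<close> is the identification of the source fiber at \<open>a\<close> of \<open>V \<otimes> V\<close> with
  \<open>\<complex>\<^sup>2 \<otimes> \<complex>\<^sup>2\<close>, and \<open>fiber_vector a\<close> is its inverse.\<close>

definition pair_label :: "complex \<Rightarrow> 2 \<times> 2 \<Rightarrow> (complex \<times> int) \<times> (complex \<times> int)" where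
  "pair_label a = (\<lambda>(i, j). ((a, sign_of i), (a + of_int (sign_of i), sign_of j)))"

definition fiber_coords ::
    "complex \<Rightarrow> ((complex \<times> int) \<times> (complex \<times> int) \<Rightarrow>\<^sub>0 complex) \<Rightarrow> complex^(2 \<times> 2)" where
  "fiber_coords a p = (\<chi> q. Poly_Mapping.lookup p (pair_label a q))"

definition fiber_vector ::
    "complex \<Rightarrow> complex^(2 \<times> 2) \<Rightarrow> ((complex \<times> int) \<times> (complex \<times> int) \<Rightarrow>\<^sub>0 complex)" where
  "fiber_vector a v = (\<Sum>q\<in>UNIV. Poly_Mapping.single (pair_label a q) (v $ q))"

definition fiber_operator :: "complex \<Rightarrow> complex^(2 \<times> 2)^(2 \<times> 2) \<Rightarrow>
    ((complex \<times> int) \<times> (complex \<times> int) \<Rightarrow>\<^sub>0 complex) \<Rightarrow>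
    ((complex \<times> int) \<times> (complex \<times> int) \<Rightarrow>\<^sub>0 complex)" where
  "fiber_operator a M p = fiber_vector a (M *v fiber_coords a p)"


section \<open>The elliptic operators\<close>

definition theta :: "complex \<Rightarrow> complex \<Rightarrow> complex" where
  "theta z \<tau> = - (\<Sum>\<^sub>\<infinity>n::int. exp (\<i> * of_real pi * (of_int n + 1/2)^2 * \<tau>
                               + 2 * of_real pi * \<i> * (of_int n + 1/2) * (z + 1/2)))"

definition ell_bracket :: "nat \<Rightarrow> complex \<Rightarrow> complex \<Rightarrow> complex" where
  "ell_bracket L \<tau> z =
     theta (z / (of_nat L + 1)) \<tau> / (deriv (\<lambda>w. theta w \<tau>) 0 / (of_nat L + 1))"

definition kappa_ell :: "nat \<Rightarrow> complex \<Rightarrow> complex \<Rightarrow> complex" where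
  "kappa_ell L \<tau> a = (ell_bracket L \<tau> (a + 1) + ell_bracket L \<tau> (a - 1)) / ell_bracket L \<tau> a"

text \<open>\<open>r a\<close> is the chosen square root of \<open>[a - 1][a + 1]\<close>.\<close>

definition TA_ell_matrix ::
    "nat \<Rightarrow> complex \<Rightarrow> (complex \<Rightarrow> complex) \<Rightarrow> complex \<Rightarrow> complex^(2 \<times> 2)^(2 \<times> 2)" where
  "TA_ell_matrix L \<tau> r a =
     (r a / ell_bracket L \<tau> a) *\<^sub>M (matrix_unit 2 1 \<otimes>\<^sub>K matrix_unit 1 2)
   + (r a / ell_bracket L \<tau> a) *\<^sub>M (matrix_unit 1 2 \<otimes>\<^sub>K matrix_unit 2 1)
   + (ell_bracket L \<tau> (a + 1) / ell_bracket L \<tau> a) *\<^sub>M (matrix_unit 1 1 \<otimes>\<^sub>K matrix_unit 2 2)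
   + (ell_bracket L \<tau> (a - 1) / ell_bracket L \<tau> a) *\<^sub>M (matrix_unit 2 2 \<otimes>\<^sub>K matrix_unit 1 1)"

definition TA_ell :: "nat \<Rightarrow> complex \<Rightarrow> (complex \<Rightarrow> complex) \<Rightarrow> complex \<Rightarrow>
    ((complex \<times> int) \<times> (complex \<times> int) \<Rightarrow>\<^sub>0 complex) \<Rightarrow>
    ((complex \<times> int) \<times> (complex \<times> int) \<Rightarrow>\<^sub>0 complex)" where
  "TA_ell L \<tau> r a = fiber_operator a (TA_ell_matrix L \<tau> r a)"

end

theory Submission
  imports Defs
begin

text \<open>The operator \<open>T(a)\<close> kills the two straight paths \<open>(\<epsilon>, \<epsilon>)\<close> and acts on the span of the two
  backtracking paths \<open>(\<epsilon>, -\<epsilon>)\<close>, which both represent the identity arrow at \<open>a\<close>, by a \<open>2 \<times> 2\<close>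
  matrix \<open>t\<^bsub>\<delta>\<epsilon>\<^esub>(a)\<close> with diagonal entries \<open>[a + \<epsilon>] / [a]\<close> and off-diagonal entries \<open>r(a) / [a]\<close>.
  Since \<open>r(a)\<^sup>2 = [a - 1][a + 1]\<close>, this matrix is symmetric of determinant zero, hence of rank one,
  which is used in the form of the exchange rule
  \<open>t\<^bsub>\<delta>\<mu>\<^esub> t\<^bsub>\<mu>\<epsilon>\<^esub> = t\<^bsub>\<mu>\<mu>\<^esub> t\<^bsub>\<delta>\<epsilon>\<^esub>\<close> (\<open>backtrack_coeff_exchange\<close>).

  Summing the exchange rule over \<open>\<mu>\<close> shows that \<open>T(a)\<^sup>2\<close> is \<open>T(a)\<close> times the trace of \<open>t(a)\<close>, and this
  trace is \<open>\<kappa>(a)\<close>.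

  In the cubic relation \<open>T\<^sup>(\<^sup>1\<^sup>2\<^sup>) T\<^sup>(\<^sup>2\<^sup>3\<^sup>) T\<^sup>(\<^sup>1\<^sup>2\<^sup>) = T\<^sup>(\<^sup>1\<^sup>2\<^sup>)\<close> the third step \<open>\<eta>\<close> of a path is fixed by the outer
  factors.  Among the paths \<open>(\<mu>, -\<mu>, \<eta>)\<close> produced by the first factor, the middle factor kills the one
  whose last two steps agree, so only \<open>\<mu> = \<eta>\<close> contributes; and of the image of \<open>(\<eta>, -\<eta>, \<eta>)\<close> the last
  factor sees only the multiple by the diagonal entry \<open>t\<^bsub>-\<eta>,-\<eta>\<^esub>(a + \<eta>) = [a] / [a + \<eta>]\<close>.  This number is
  the inverse of \<open>t\<^bsub>\<eta>\<eta>\<^esub>(a)\<close> (\<open>backtrack_coeff_diag_reciprocal\<close>), so the exchange rule at \<open>\<mu> = \<eta>\<close>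
  gives back \<open>T\<^sup>(\<^sup>1\<^sup>2\<^sup>)\<close>.  The other cubic relation is the mirror image, with the first step fixed.

  All maps involved are complex linear, so each relation is checked on basis vectors only
  (\<open>complex_linear_eqI\<close>).\<close>

section \<open>Complex-linear maps on free vector spaces\<close>

abbreviation unit_vec :: "'i \<Rightarrow> ('i \<Rightarrow>\<^sub>0 complex)" where
  "unit_vec i \<equiv> Poly_Mapping.single i 1"

definition complex_linear :: "(('i \<Rightarrow>\<^sub>0 complex) \<Rightarrow> ('j \<Rightarrow>\<^sub>0 complex)) \<Rightarrow> bool" where
  "complex_linear f \<longleftrightarrow> (\<forall>p q. f (p + q) = f p + f q) \<and> (\<forall>c p. f (cscale c p) = cscale c (f p))"

lemma lookup_cscale [simp]: "Poly_Mapping.lookup (cscale c p) i = c * Poly_Mapping.lookup p i"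
  unfolding cscale_def by (simp add: Poly_Mapping.map.rep_eq when_def)

lemma cscale_cscale [simp]: "cscale c (cscale d p) = cscale (c * d) p"
  by (intro poly_mapping_eqI) simp

lemma cscale_0 [simp]: "cscale 0 p = 0"
  by (intro poly_mapping_eqI) simp

lemma cscale_zero_right [simp]: "cscale c 0 = 0"
  by (intro poly_mapping_eqI) simp

lemma cscale_1 [simp]: "cscale 1 p = p"
  by (intro poly_mapping_eqI) simp

lemma cscale_add: "cscale c (p + q) = cscale c p + cscale c q"
  by (intro poly_mapping_eqI) (simp add: lookup_add algebra_simps)

lemma cscale_add_left: "cscale (c + d) p = cscale c p + cscale d p"
  by (intro poly_mapping_eqI) (simp add: lookup_add algebra_simps)

lemma cscale_sum: "cscale c (\<Sum>i\<in>A. h i) = (\<Sum>i\<in>A. cscale c (h i))"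
  by (induction A rule: infinite_finite_induct) (simp_all add: cscale_add)

lemma cscale_sum_left: "cscale (\<Sum>i\<in>A. c i) p = (\<Sum>i\<in>A. cscale (c i) p)"
  by (induction A rule: infinite_finite_induct) (simp_all add: cscale_add_left)

lemma complex_linear_add: "complex_linear f \<Longrightarrow> f (p + q) = f p + f q"
  and complex_linear_cscale: "complex_linear f \<Longrightarrow> f (cscale c p) = cscale c (f p)"
  by (simp_all add: complex_linear_def)

lemma complex_linear_zero: "complex_linear f \<Longrightarrow> f 0 = 0"
  using complex_linear_cscale[of f 0 0] by simp

lemma complex_linear_sum:
  assumes "complex_linear f"
  shows "f (\<Sum>i\<in>A. g i) = (\<Sum>i\<in>A. f (g i))"
  by (induction A rule: infinite_finite_induct)
    (simp_all add: complex_linear_zero[OF assms] complex_linear_add[OF assms])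

lemma complex_linear_compose:
  "complex_linear f \<Longrightarrow> complex_linear g \<Longrightarrow> complex_linear (\<lambda>p. f (g p))"
  by (simp add: complex_linear_def)

lemma complex_linear_scaled: "complex_linear f \<Longrightarrow> complex_linear (\<lambda>p. cscale c (f p))"
  by (simp add: complex_linear_def cscale_add mult.commute)

lemma linear_ext_superset:
  assumes "finite S" "Poly_Mapping.keys p \<subseteq> S"
  shows "linear_ext g p = (\<Sum>i\<in>S. cscale (Poly_Mapping.lookup p i) (g i))"
  unfolding linear_ext_def
  using assms by (intro sum.mono_neutral_left) (auto simp: in_keys_iff)

lemma complex_linear_linear_ext: "complex_linear (linear_ext g)"
  unfolding complex_linear_def
proof (intro conjI allI)
  fix p q :: "'a \<Rightarrow>\<^sub>0 complex" and c
  let ?S = "Poly_Mapping.keys p \<union> Poly_Mapping.keys q"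
  have S: "finite ?S" "Poly_Mapping.keys p \<subseteq> ?S" "Poly_Mapping.keys q \<subseteq> ?S"
    "Poly_Mapping.keys (p + q) \<subseteq> ?S" "Poly_Mapping.keys (cscale c p) \<subseteq> ?S"
    using keys_add[of p q] by (auto simp: in_keys_iff)
  show "linear_ext g (p + q) = linear_ext g p + linear_ext g q"
    by (simp add: linear_ext_superset[OF S(1)] S lookup_add cscale_add_left sum.distrib)
  show "linear_ext g (cscale c p) = cscale c (linear_ext g p)"
    by (simp add: linear_ext_superset[OF S(1)] S cscale_sum)
qed

lemma linear_ext_unit_vec [simp]: "linear_ext g (unit_vec i) = g i"
  by (simp add: linear_ext_def)

lemma cscale_unit_vec: "cscale c (unit_vec i) = Poly_Mapping.single i c"
  by (simp add: cscale_def)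

lemma unit_vec_expansion:
  "p = (\<Sum>i\<in>Poly_Mapping.keys p. cscale (Poly_Mapping.lookup p i) (unit_vec i))"
proof (rule poly_mapping_eqI)
  fix k
  have "Poly_Mapping.lookup (\<Sum>i\<in>Poly_Mapping.keys p. cscale (Poly_Mapping.lookup p i) (unit_vec i)) k
      = (\<Sum>i\<in>Poly_Mapping.keys p. if k = i then Poly_Mapping.lookup p i else 0)"
    unfolding lookup_sum cscale_unit_vec
    by (intro sum.cong refl) (simp add: lookup_single when_def)
  then show "Poly_Mapping.lookup p k = Poly_Mapping.lookup
      (\<Sum>i\<in>Poly_Mapping.keys p. cscale (Poly_Mapping.lookup p i) (unit_vec i)) k"
    by (simp add: in_keys_iff)
qed

lemma complex_linear_expansion:
  assumes "complex_linear f"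
  shows "f p = (\<Sum>i\<in>Poly_Mapping.keys p. cscale (Poly_Mapping.lookup p i) (f (unit_vec i)))"
proof -
  have "f p = f (\<Sum>i\<in>Poly_Mapping.keys p. cscale (Poly_Mapping.lookup p i) (unit_vec i))"
    using unit_vec_expansion[of p] by (rule arg_cong)
  then show ?thesis
    by (simp add: complex_linear_sum[OF assms] complex_linear_cscale[OF assms])
qed

text \<open>Linear maps are compared only on the basis vectors occurring in \<open>p\<close>, so that it suffices to verify
  the relations on basis vectors of the source fiber in question.\<close>

lemma complex_linear_eqI:
  assumes "complex_linear f" "complex_linear g"
    and "\<And>i. i \<in> Poly_Mapping.keys p \<Longrightarrow> f (unit_vec i) = g (unit_vec i)"
  shows "f p = g p"
  unfolding complex_linear_expansion[OF assms(1), of p] complex_linear_expansion[OF assms(2), of p]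
  using assms(3) by simp

lemma component_sum:
  "(\<And>i. i \<in> A \<Longrightarrow> h i \<in> component V \<gamma>) \<Longrightarrow> (\<Sum>i\<in>A. h i) \<in> component V \<gamma>"
proof (induction A rule: infinite_finite_induct)
  case (insert x A)
  then show ?case
    using keys_add[of "h x" "sum h A"] by (auto simp: component_def)
qed (auto simp: component_def)

lemma component_cscale: "p \<in> component V \<gamma> \<Longrightarrow> cscale c p \<in> component V \<gamma>"
  by (auto simp: component_def in_keys_iff)

section \<open>Composable steps\<close>

lemma shifted_ints_step:
  assumes "a \<in> shifted_ints b"
  shows "a + of_int n \<in> shifted_ints b"
proof -
  from assms obtain m where "a = of_int m + b" by (auto simp: shifted_ints_def)
  then have "a + of_int n = of_int (m + n) + b" by simp
  then show ?thesis unfolding shifted_ints_def by blast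
qed

lemma piA_tensor_basis:
  "((a, \<epsilon>), (a', \<epsilon>')) \<in> basis (tensor (piA b) (VA b) (VA b)) \<longleftrightarrow>
     a \<in> shifted_ints b \<and> \<epsilon> \<in> {1, -1} \<and> \<epsilon>' \<in> {1, -1} \<and> a' = a + of_int \<epsilon>"
    (is "?lhs \<longleftrightarrow> ?rhs")
proof
  assume ?lhs
  then have "a \<in> shifted_ints b" "\<epsilon> \<in> {1, -1}" "a' \<in> shifted_ints b" "\<epsilon>' \<in> {1, -1}"
    and "tgt (piA b) (step_arrow b (a, \<epsilon>)) = src (piA b) (step_arrow b (a', \<epsilon>'))"
    by (simp_all add: tensor_def VA_def)
  then show ?rhs by (metis step_arrow_ends)
next
  assume r: ?rhs
  then have "tgt (piA b) (step_arrow b (a, \<epsilon>)) = src (piA b) (step_arrow b (a', \<epsilon>'))"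
    by (metis shifted_ints_step step_arrow_ends)
  with r show ?lhs
    using shifted_ints_step[of a b \<epsilon>] by (simp add: tensor_def VA_def)
qed

lemma src_deg_tensor:
  assumes "is_groupoid G" "is_graded_space G V" "is_graded_space G W"
    and "(i, j) \<in> basis (tensor G V W)"
  shows "src G (deg (tensor G V W) (i, j)) = src G (deg V i)"
proof -
  have "deg V i \<in> Ar G" "deg W j \<in> Ar G" "tgt G (deg V i) = src G (deg W j)"
    using assms by (auto simp: is_graded_space_def tensor_def)
  then show ?thesis
    using assms(1) unfolding is_groupoid_def by (auto simp: tensor_def)
qed

lemma is_groupoid_piA: "is_groupoid (piA b)"
  by (simp add: piA_def is_groupoid_graph_groupoid)

lemma src_deg_VA_tensor:
  assumes "is_graded_space (piA b) W" "((a, \<epsilon>), j) \<in> basis (tensor (piA b) (VA b) W)"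
  shows "src (piA b) (deg (tensor (piA b) (VA b) W) ((a, \<epsilon>), j)) = a"
proof -
  have "a \<in> shifted_ints b" "\<epsilon> \<in> {1, -1}"
    using assms(2) by (auto simp: tensor_def VA_def)
  then show ?thesis
    unfolding src_deg_tensor[OF is_groupoid_piA is_graded_space_VA assms]
    by (simp add: VA_def step_arrow_ends)
qed

lemma source_fiber_two_steps:
  assumes "p \<in> source_fiber (piA b) (tensor (piA b) (VA b) (VA b)) a"
    and "i \<in> Poly_Mapping.keys p"
  obtains \<epsilon> \<epsilon>' where "\<epsilon> \<in> {1, -1}" "\<epsilon>' \<in> {1, -1}" "i = ((a, \<epsilon>), (a + of_int \<epsilon>, \<epsilon>'))"
proof -
  obtain a1 \<epsilon> a2 \<epsilon>' where i: "i = ((a1, \<epsilon>), (a2, \<epsilon>'))" by (metis surj_pair)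
  have b: "i \<in> basis (tensor (piA b) (VA b) (VA b))"
    and s: "src (piA b) (deg (tensor (piA b) (VA b) (VA b)) i) = a"
    using assms by (auto simp: source_fiber_def)
  have "a1 = a"
    using s src_deg_VA_tensor[OF is_graded_space_VA] b unfolding i by metis
  with b show thesis using that i by (auto simp: piA_tensor_basis)
qed

lemma source_fiber_three_steps:
  assumes "p \<in> source_fiber (piA b) (tensor (piA b) (VA b) (tensor (piA b) (VA b) (VA b))) a"
    and "i \<in> Poly_Mapping.keys p"
  obtains \<epsilon>1 \<epsilon>2 \<epsilon>3 where "\<epsilon>1 \<in> {1, -1}" "\<epsilon>2 \<in> {1, -1}" "\<epsilon>3 \<in> {1, -1}"
    "i = ((a, \<epsilon>1), (a + of_int \<epsilon>1, \<epsilon>2), (a + of_int \<epsilon>1 + of_int \<epsilon>2, \<epsilon>3))"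
proof -
  let ?W = "tensor (piA b) (VA b) (VA b)"
  have W: "is_graded_space (piA b) ?W"
    by (intro is_graded_space_tensor is_groupoid_piA is_graded_space_VA)
  obtain a1 \<epsilon>1 a2 \<epsilon>2 a3 \<epsilon>3 where i: "i = ((a1, \<epsilon>1), (a2, \<epsilon>2), (a3, \<epsilon>3))" by (metis surj_pair)
  have b: "i \<in> basis (tensor (piA b) (VA b) ?W)"
    and s: "src (piA b) (deg (tensor (piA b) (VA b) ?W) i) = a"
    using assms by (auto simp: source_fiber_def)
  have a1: "a1 = a"
    using s src_deg_VA_tensor[OF W] b unfolding i by metis
  have j: "((a2, \<epsilon>2), (a3, \<epsilon>3)) \<in> basis ?W" and e1: "a \<in> shifted_ints b" "\<epsilon>1 \<in> {1, -1}"
    and "tgt (piA b) (deg (VA b) (a, \<epsilon>1)) = src (piA b) (deg ?W ((a2, \<epsilon>2), (a3, \<epsilon>3)))"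
    using b unfolding i a1 by (simp_all add: tensor_def VA_def)
  then have "a2 = a + of_int \<epsilon>1"
    unfolding src_deg_VA_tensor[OF is_graded_space_VA j] by (simp add: VA_def step_arrow_ends)
  with j e1 show thesis
    using that i a1 by (auto simp: piA_tensor_basis)
qed

text \<open>Both backtracks at \<open>a\<close> are homogeneous of degree the identity arrow.  Hence mixing them, as the
  off-diagonal terms of the operator do, preserves the grading, and only one component of the source
  fiber is affected.\<close>

lemma deg_backtrack:
  assumes "a \<in> shifted_ints b" "\<epsilon> \<in> {1, -1}"
  shows "deg (tensor (piA b) (VA b) (VA b)) ((a, \<epsilon>), (a + of_int \<epsilon>, - \<epsilon>)) = idn (piA b) a"
proof -
  let ?V = "shifted_ints b" and ?E = "piA_edges b"
  have e: "- \<epsilon> \<in> {1, -1}" using assms(2) by auto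
  note w = step_walk[OF assms] step_walk[OF shifted_ints_step[OF assms(1)] e, of \<epsilon>]
  have w3: "[a, a + of_int \<epsilon>, a] \<in> walks ?V ?E" and w1: "[a] \<in> walks ?V ?E"
    using walk_append[OF w] assms(1) by (simp_all add: walks_def)
  have "([a, a + of_int \<epsilon>, a], [a]) \<in> backtrack ?V ?E"
    using w3 w1 unfolding backtrack_def by (auto intro!: exI[of _ "[]"])
  then have "([a, a + of_int \<epsilon>, a], [a]) \<in> walk_equiv ?V ?E"
    using w3 w1 by (auto simp: walk_equiv_def)
  then have "walk_class ?V ?E [a, a + of_int \<epsilon>, a] = walk_class ?V ?E [a]"
    by (simp add: walk_class_eq_iff[OF w3 w1])
  moreover have "deg (tensor (piA b) (VA b) (VA b)) ((a, \<epsilon>), (a + of_int \<epsilon>, - \<epsilon>))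
      = walk_class ?V ?E [a, a + of_int \<epsilon>, a]"
    using cmp_walk_class[OF w] by (simp add: tensor_def VA_def step_arrow_def piA_def)
  ultimately show ?thesis
    by (simp add: piA_def graph_groupoid_def)
qed

section \<open>The operator on pairs of steps\<close>

text \<open>The matrix \<open>t\<^bsub>\<delta>\<epsilon>\<^esub>(a)\<close> of the operator in the basis of the two backtracks at \<open>a\<close>.\<close>

definition backtrack_coeff :: "nat \<Rightarrow> complex \<Rightarrow> (complex \<Rightarrow> complex) \<Rightarrow> complex \<Rightarrow> int \<Rightarrow> int \<Rightarrow> complex"
  where "backtrack_coeff L \<tau> r a \<delta> \<epsilon> =
    (if \<delta> = \<epsilon> then ell_bracket L \<tau> (a + of_int \<epsilon>) else r a) / ell_bracket L \<tau> a"

lemma complex_linear_fiber_operator: "complex_linear (fiber_operator a M)"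
proof -
  have "fiber_coords a (p + q) = fiber_coords a p + fiber_coords a q"
    "fiber_coords a (cscale c p) = c *s fiber_coords a p" for p q c
    by (simp_all add: fiber_coords_def lookup_add vec_eq_iff)
  moreover have "fiber_vector a (v + w) = fiber_vector a v + fiber_vector a w" for v w
    by (simp add: fiber_vector_def single_add sum.distrib)
  moreover have "fiber_vector a (c *s v) = cscale c (fiber_vector a v)" for v c
    unfolding fiber_vector_def cscale_sum by (simp add: cscale_def)
  ultimately show ?thesis
    by (simp add: complex_linear_def fiber_operator_def matrix_vector_right_distrib
        vector_scalar_commute)
qed

lemma complex_linear_TA_ell: "complex_linear (TA_ell L \<tau> r a)"
  by (simp add: TA_ell_def complex_linear_fiber_operator)

lemma fiber_coords_pair_label: "fiber_coords a (unit_vec (pair_label a q)) = axis q 1"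
proof -
  have "pair_label a q = pair_label a q' \<longleftrightarrow> q = q'" for q q'
    using exhaust_2[of "fst q"] exhaust_2[of "snd q"] exhaust_2[of "fst q'"] exhaust_2[of "snd q'"]
    by (cases q; cases q') (auto simp: pair_label_def sign_of_def)
  then show ?thesis
    by (simp add: fiber_coords_def lookup_single axis_def vec_eq_iff when_def)
qed

lemma sum_UNIV_2_times_2:
  "(\<Sum>q\<in>(UNIV :: (2 \<times> 2) set). f q) = f (1, 1) + f (1, 2) + f (2, 1) + f (2, 2)"
proof -
  have "(\<Sum>q\<in>(UNIV :: (2 \<times> 2) set). f q) = (\<Sum>i\<in>UNIV. \<Sum>j\<in>UNIV. f (i, j))"
    by (simp add: sum.cartesian_product)
  then show ?thesis by (simp add: sum_2 add.assoc)
qed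

lemma fiber_operator_unit_vec:
  "fiber_operator a M (unit_vec (pair_label a q)) =
    (\<Sum>p\<in>UNIV. cscale (M $ p $ q) (unit_vec (pair_label a p)))"
proof -
  have "(M *v axis q 1) $ p = M $ p $ q" for p
    by (simp add: matrix_vector_mult_def axis_def if_distrib cong: if_cong)
  then show ?thesis
    by (simp add: fiber_operator_def fiber_coords_pair_label fiber_vector_def cscale_unit_vec)
qed

lemma TA_ell_matrix_entry:
  "TA_ell_matrix L \<tau> r a $ (k, l) $ (i, j) =
    (if k \<noteq> l \<and> i \<noteq> j then backtrack_coeff L \<tau> r a (sign_of k) (sign_of i) else 0)"
  using exhaust_2[of i] exhaust_2[of j] exhaust_2[of k] exhaust_2[of l]
  by (elim disjE) (simp_all add: TA_ell_matrix_def kron_def mscale_def matrix_unit_def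
      backtrack_coeff_def sign_of_def)

lemma TA_ell_pair_label:
  "TA_ell L \<tau> r a (unit_vec (pair_label a (i, j))) =
    (if i = j then 0
     else \<Sum>\<delta>\<in>{1, -1}. cscale (backtrack_coeff L \<tau> r a \<delta> (sign_of i))
       (unit_vec ((a, \<delta>), (a + of_int \<delta>, - \<delta>))))"
  unfolding TA_ell_def fiber_operator_unit_vec sum_UNIV_2_times_2
  by (simp add: TA_ell_matrix_entry) (simp add: pair_label_def sign_of_def)

lemma TA_ell_straight:
  assumes "\<epsilon> \<in> {1, -1}"
  shows "TA_ell L \<tau> r a (unit_vec ((a, \<epsilon>), (a + of_int \<epsilon>, \<epsilon>))) = 0"
proof -
  have "sign_of 1 = 1" "sign_of 2 = -1" by (simp_all add: sign_of_def)
  with assms obtain i where "\<epsilon> = sign_of i" by (metis insertE singletonD)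
  then show ?thesis
    using TA_ell_pair_label[of L \<tau> r a i i] by (simp add: pair_label_def)
qed

lemma TA_ell_backtrack:
  assumes "\<epsilon> \<in> {1, -1}"
  shows "TA_ell L \<tau> r a (unit_vec ((a, \<epsilon>), (a + of_int \<epsilon>, - \<epsilon>))) =
    (\<Sum>\<delta>\<in>{1, -1}. cscale (backtrack_coeff L \<tau> r a \<delta> \<epsilon>) (unit_vec ((a, \<delta>), (a + of_int \<delta>, - \<delta>))))"
proof -
  from assms consider "\<epsilon> = 1" | "\<epsilon> = -1" by auto
  then obtain i j where "i \<noteq> j" "sign_of i = \<epsilon>" "sign_of j = - \<epsilon>"
  proof cases
    case 1
    then show thesis using that[of 1 2] by (simp add: sign_of_def)
  next
    case 2
    then show thesis using that[of 2 1] by (simp add: sign_of_def)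
  qed
  then show ?thesis
    using TA_ell_pair_label[of L \<tau> r a i j] by (simp only: pair_label_def prod.case if_False)
qed

text \<open>The matrix \<open>t(a)\<close> is \<open>v v\<^sup>T / [a]\<close> for a vector \<open>v\<close> whose entries are square roots of \<open>[a + 1]\<close>
  and \<open>[a - 1]\<close> with product \<open>r a\<close>, so both sides are \<open>v\<^sub>\<delta> v\<^sub>\<mu>\<^sup>2 v\<^sub>\<epsilon> / [a]\<^sup>2\<close>.  The proof avoids choosing \<open>v\<close>:
  the two sides differ by more than commutation only if \<open>\<mu> = -\<epsilon> = -\<delta>\<close>, and that case is the vanishing of
  the determinant.\<close>

lemma backtrack_coeff_exchange:
  assumes "(r a)\<^sup>2 = ell_bracket L \<tau> (a - 1) * ell_bracket L \<tau> (a + 1)"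
    and "\<delta> \<in> {1, -1}" "\<epsilon> \<in> {1, -1}" "\<mu> \<in> {1, -1}"
  shows "backtrack_coeff L \<tau> r a \<delta> \<mu> * backtrack_coeff L \<tau> r a \<mu> \<epsilon> =
    backtrack_coeff L \<tau> r a \<mu> \<mu> * backtrack_coeff L \<tau> r a \<delta> \<epsilon>"
proof -
  consider "\<mu> = \<delta>" | "\<mu> = \<epsilon>" | "\<delta> = \<epsilon>" "\<mu> = - \<epsilon>" "\<mu> \<noteq> \<epsilon>" using assms(2-4) by auto
  then show ?thesis
  proof cases
    case 3
    have "ell_bracket L \<tau> (a + of_int \<mu>) * ell_bracket L \<tau> (a + of_int \<epsilon>) = r a * r a"
      using assms(1,3) 3 by (auto simp: power2_eq_square)
    then show ?thesis
      using 3 by (simp add: backtrack_coeff_def)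
  qed simp_all
qed

text \<open>The step \<open>\<mu>\<close> at \<open>a\<close> and the reverse step at \<open>a + \<mu>\<close> have weights \<open>[a + \<mu>] / [a]\<close> and
  \<open>[a] / [a + \<mu>]\<close>.  That these cancel makes the constant in both cubic relations equal to one.\<close>

lemma backtrack_coeff_diag_reciprocal:
  assumes "ell_bracket L \<tau> a \<noteq> 0" "ell_bracket L \<tau> (a + of_int \<mu>) \<noteq> 0"
  shows "backtrack_coeff L \<tau> r a \<mu> \<mu> * backtrack_coeff L \<tau> r (a + of_int \<mu>) (- \<mu>) (- \<mu>) = 1"
  using assms by (simp add: backtrack_coeff_def)

lemma kappa_ell_eq_trace: "kappa_ell L \<tau> a = (\<Sum>\<mu>\<in>{1, -1}. backtrack_coeff L \<tau> r a \<mu> \<mu>)"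
  by (simp add: kappa_ell_def backtrack_coeff_def add_divide_distrib)

lemma TA_ell_idempotent_up_to_kappa:
  assumes "(r a)\<^sup>2 = ell_bracket L \<tau> (a - 1) * ell_bracket L \<tau> (a + 1)"
    and p: "p \<in> source_fiber (piA b) (tensor (piA b) (VA b) (VA b)) a"
  shows "TA_ell L \<tau> r a (TA_ell L \<tau> r a p) = cscale (kappa_ell L \<tau> a) (TA_ell L \<tau> r a p)"
proof (rule complex_linear_eqI[where
      f = "\<lambda>p. TA_ell L \<tau> r a (TA_ell L \<tau> r a p)" and
      g = "\<lambda>p. cscale (kappa_ell L \<tau> a) (TA_ell L \<tau> r a p)"])
  note lin = complex_linear_TA_ell[of L \<tau> r a]
  show "complex_linear (\<lambda>p. TA_ell L \<tau> r a (TA_ell L \<tau> r a p))"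
    "complex_linear (\<lambda>p. cscale (kappa_ell L \<tau> a) (TA_ell L \<tau> r a p))"
    by (rule complex_linear_compose[OF lin lin], rule complex_linear_scaled[OF lin])
  let ?t = "backtrack_coeff L \<tau> r a"
  let ?x = "\<lambda>\<delta>. unit_vec ((a, \<delta>), (a + of_int \<delta>, - \<delta>))"
  fix i assume "i \<in> Poly_Mapping.keys p"
  with p obtain \<epsilon> \<epsilon>' where e: "\<epsilon> \<in> {1, -1}" "\<epsilon>' \<in> {1, -1}" "i = ((a, \<epsilon>), (a + of_int \<epsilon>, \<epsilon>'))"
    by (rule source_fiber_two_steps)
  show "TA_ell L \<tau> r a (TA_ell L \<tau> r a (unit_vec i)) = cscale (kappa_ell L \<tau> a) (TA_ell L \<tau> r a (unit_vec i))"
  proof (cases "\<epsilon>' = \<epsilon>")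
    case True
    then show ?thesis
      using e TA_ell_straight[OF e(1)] complex_linear_zero[OF lin] by simp
  next
    case False
    then have i: "unit_vec i = ?x \<epsilon>" using e by auto
    have exchange: "?t \<mu> \<epsilon> * ?t \<delta> \<mu> = ?t \<mu> \<mu> * ?t \<delta> \<epsilon>" if "\<delta> \<in> {1, -1}" "\<mu> \<in> {1, -1}" for \<delta> \<mu>
      using backtrack_coeff_exchange[of r a L \<tau>, OF assms(1) that(1) e(1) that(2)]
      by (simp only: mult.commute)
    have "TA_ell L \<tau> r a (TA_ell L \<tau> r a (?x \<epsilon>))
        = (\<Sum>\<mu>\<in>{1, -1}. cscale (?t \<mu> \<epsilon>) (\<Sum>\<delta>\<in>{1, -1}. cscale (?t \<delta> \<mu>) (?x \<delta>)))"
      unfolding TA_ell_backtrack[OF e(1)] complex_linear_sum[OF lin] complex_linear_cscale[OF lin]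
      by (intro sum.cong refl) (simp only: TA_ell_backtrack)
    also have "\<dots> = (\<Sum>\<mu>\<in>{1, -1}. cscale (?t \<mu> \<mu>) (\<Sum>\<delta>\<in>{1, -1}. cscale (?t \<delta> \<epsilon>) (?x \<delta>)))"
      unfolding cscale_sum cscale_cscale
      by (intro sum.cong refl) (simp only: exchange)
    also have "\<dots> = cscale (kappa_ell L \<tau> a) (TA_ell L \<tau> r a (?x \<epsilon>))"
      by (simp only: TA_ell_backtrack[OF e(1)] kappa_ell_eq_trace[of L \<tau> a r] cscale_sum_left)
    finally show ?thesis unfolding i .
  qed
qed

text \<open>The only delicate clauses are preservation of components and finiteness of the support: an
  arrow \<open>\<gamma>\<close> on whose component the operator does not vanish must be the degree of a backtrack, so it
  is the identity arrow at \<open>a\<close>.\<close>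

lemma TA_ell_in_fiber_End:
  assumes a: "a \<in> shifted_ints b"
  shows "TA_ell L \<tau> r a \<in> fiber_End (piA b) (tensor (piA b) (VA b) (VA b)) a"
proof -
  let ?W = "tensor (piA b) (VA b) (VA b)"
  note lin = complex_linear_TA_ell[of L \<tau> r a]
  have unit: "TA_ell L \<tau> r a (unit_vec i) = 0 \<or>
      \<gamma> = idn (piA b) a \<and> TA_ell L \<tau> r a (unit_vec i) \<in> component ?W \<gamma>"
    if g: "\<gamma> \<in> Ar (piA b)" "src (piA b) \<gamma> = a" and p: "p \<in> component ?W \<gamma>"
      and i: "i \<in> Poly_Mapping.keys p" for \<gamma> p i
  proof -
    have d: "deg ?W i = \<gamma>" using p i by (auto simp: component_def)
    have "p \<in> source_fiber (piA b) ?W a"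
      using p g by (auto simp: component_def source_fiber_def)
    then obtain \<epsilon> \<epsilon>' where e: "\<epsilon> \<in> {1, -1}" "\<epsilon>' \<in> {1, -1}" "i = ((a, \<epsilon>), (a + of_int \<epsilon>, \<epsilon>'))"
      using i by (rule source_fiber_two_steps)
    show ?thesis
    proof (cases "\<epsilon>' = \<epsilon>")
      case True
      then show ?thesis using e TA_ell_straight by auto
    next
      case False
      then have i': "i = ((a, \<epsilon>), (a + of_int \<epsilon>, - \<epsilon>))" using e by auto
      have \<gamma>: "\<gamma> = idn (piA b) a"
        using d deg_backtrack[OF a e(1)] i' by simp
      have "unit_vec ((a, \<delta>), (a + of_int \<delta>, - \<delta>)) \<in> component ?W \<gamma>" if "\<delta> \<in> {1, -1}" for \<delta>
        using a that deg_backtrack[OF a that] \<gamma> by (auto simp: component_def piA_tensor_basis)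
      then have "TA_ell L \<tau> r a (unit_vec i) \<in> component ?W \<gamma>"
        unfolding i' TA_ell_backtrack[OF e(1)]
        by (intro component_sum component_cscale)
      with \<gamma> show ?thesis by blast
    qed
  qed
  have "TA_ell L \<tau> r a p \<in> component ?W \<gamma>"
    if g: "\<gamma> \<in> Ar (piA b)" "src (piA b) \<gamma> = a" and p: "p \<in> component ?W \<gamma>" for \<gamma> p
  proof -
    have "0 \<in> component ?W \<gamma>" by (simp add: component_def)
    then have "TA_ell L \<tau> r a (unit_vec i) \<in> component ?W \<gamma>" if "i \<in> Poly_Mapping.keys p" for i
      using unit[OF g p that] by auto
    then show ?thesis
      unfolding complex_linear_expansion[OF lin, of p]
      by (intro component_sum component_cscale)
  qed
  moreover have "\<gamma> = idn (piA b) a"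
    if g: "\<gamma> \<in> Ar (piA b)" "src (piA b) \<gamma> = a" and p: "p \<in> component ?W \<gamma>"
      and nz: "TA_ell L \<tau> r a p \<noteq> 0" for \<gamma> p
  proof (rule ccontr)
    assume "\<gamma> \<noteq> idn (piA b) a"
    then have "TA_ell L \<tau> r a (unit_vec i) = 0" if "i \<in> Poly_Mapping.keys p" for i
      using unit[OF g p that] by auto
    then show False
      using nz complex_linear_expansion[OF lin, of p] by simp
  qed
  then have "{\<gamma> \<in> Ar (piA b). src (piA b) \<gamma> = a \<and> (\<exists>p\<in>component ?W \<gamma>. TA_ell L \<tau> r a p \<noteq> 0)}
      \<subseteq> {idn (piA b) a}"
    by blast
  then have "finite {\<gamma> \<in> Ar (piA b). src (piA b) \<gamma> = a \<and> (\<exists>p\<in>component ?W \<gamma>. TA_ell L \<tau> r a p \<noteq> 0)}"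
    by (rule finite_subset) simp
  ultimately show ?thesis
    using complex_linear_add[OF lin] complex_linear_cscale[OF lin]
    by (auto simp: fiber_End_def)
qed

section \<open>The operator on triples of steps\<close>

lemma complex_linear_op12: "complex_linear (op12 X a)"
  and complex_linear_op23: "complex_linear (op23 G V X)"
  by (simp_all add: op12_def op23_def complex_linear_linear_ext)

text \<open>In a path of three steps from \<open>a\<close> whose first two steps \<open>(\<epsilon>, -\<epsilon>)\<close> backtrack, the third step
  \<open>\<eta>\<close> starts at \<open>a\<close> again; if instead the last two steps backtrack, \<open>\<eta>\<close> denotes the first step.
  The path \<open>(\<eta>, -\<eta>, \<eta>)\<close> is of both kinds, being \<open>first_back a \<eta> \<eta>\<close> and \<open>last_back a \<eta> (- \<eta>)\<close>.\<close>

abbreviation first_back :: "complex \<Rightarrow> int \<Rightarrow> int \<Rightarrow>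
    ((complex \<times> int) \<times> (complex \<times> int) \<times> (complex \<times> int)) \<Rightarrow>\<^sub>0 complex"
  where "first_back a \<eta> \<epsilon> \<equiv> unit_vec ((a, \<epsilon>), (a + of_int \<epsilon>, - \<epsilon>), (a, \<eta>))"

abbreviation last_back :: "complex \<Rightarrow> int \<Rightarrow> int \<Rightarrow>
    ((complex \<times> int) \<times> (complex \<times> int) \<times> (complex \<times> int)) \<Rightarrow>\<^sub>0 complex"
  where "last_back a \<eta> \<epsilon> \<equiv>
    unit_vec ((a, \<eta>), (a + of_int \<eta>, \<epsilon>), (a + of_int \<eta> + of_int \<epsilon>, - \<epsilon>))"

lemma op12_straight:
  assumes "\<epsilon> \<in> {1, -1}"
  shows "op12 (TA_ell L \<tau> r) a (unit_vec ((a, \<epsilon>), (a + of_int \<epsilon>, \<epsilon>), k)) = 0"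
  using TA_ell_straight[OF assms] complex_linear_zero[OF complex_linear_linear_ext]
  by (simp add: op12_def)

lemma op12_first_back:
  assumes "\<epsilon> \<in> {1, -1}"
  shows "op12 (TA_ell L \<tau> r) a (first_back a \<eta> \<epsilon>) =
    (\<Sum>\<delta>\<in>{1, -1}. cscale (backtrack_coeff L \<tau> r a \<delta> \<epsilon>) (first_back a \<eta> \<delta>))"
  unfolding op12_def linear_ext_unit_vec prod.case TA_ell_backtrack[OF assms]
    complex_linear_sum[OF complex_linear_linear_ext]
    complex_linear_cscale[OF complex_linear_linear_ext] ..

lemma op23_straight:
  assumes "a \<in> shifted_ints b" "\<eta> \<in> {1, -1}" "\<epsilon> \<in> {1, -1}"
  shows "op23 (piA b) (VA b) (TA_ell L \<tau> r)
    (unit_vec ((a, \<eta>), (a + of_int \<eta>, \<epsilon>), (a + of_int \<eta> + of_int \<epsilon>, \<epsilon>))) = 0"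
proof -
  have "tgt (piA b) (deg (VA b) (a, \<eta>)) = a + of_int \<eta>"
    using assms by (simp add: VA_def step_arrow_ends)
  then show ?thesis
    using TA_ell_straight[OF assms(3)] complex_linear_zero[OF complex_linear_linear_ext]
    by (simp add: op23_def)
qed

lemma op23_last_back:
  assumes "a \<in> shifted_ints b" "\<eta> \<in> {1, -1}" "\<epsilon> \<in> {1, -1}"
  shows "op23 (piA b) (VA b) (TA_ell L \<tau> r) (last_back a \<eta> \<epsilon>) =
    (\<Sum>\<delta>\<in>{1, -1}. cscale (backtrack_coeff L \<tau> r (a + of_int \<eta>) \<delta> \<epsilon>) (last_back a \<eta> \<delta>))"
proof -
  have t: "tgt (piA b) (deg (VA b) (a, \<eta>)) = a + of_int \<eta>"
    using assms by (simp add: VA_def step_arrow_ends)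
  show ?thesis
    unfolding op23_def linear_ext_unit_vec prod.case t TA_ell_backtrack[OF assms(3)]
      complex_linear_sum[OF complex_linear_linear_ext]
      complex_linear_cscale[OF complex_linear_linear_ext] ..
qed

text \<open>If \<open>\<epsilon> \<noteq> \<eta>\<close>, the last two steps agree and the inner operator vanishes.  For \<open>\<epsilon> = \<eta>\<close> the inner operator
  produces a multiple of the same vector plus a multiple of the path \<open>(\<eta>, \<eta>, -\<eta>)\<close>, which the outer
  one kills.\<close>

lemma op12_op23_first_back:
  assumes "a \<in> shifted_ints b" "\<eta> \<in> {1, -1}" "\<epsilon> \<in> {1, -1}"
  shows "op12 (TA_ell L \<tau> r) a (op23 (piA b) (VA b) (TA_ell L \<tau> r) (first_back a \<eta> \<epsilon>)) =
    (if \<epsilon> = \<eta> then cscale (backtrack_coeff L \<tau> r (a + of_int \<eta>) (- \<eta>) (- \<eta>))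
       (op12 (TA_ell L \<tau> r) a (first_back a \<eta> \<eta>)) else 0)"
proof (cases "\<epsilon> = \<eta>")
  case True
  note lin = complex_linear_op12[of "TA_ell L \<tau> r" a]
  let ?t = "backtrack_coeff L \<tau> r (a + of_int \<eta>)"
  have m: "- \<eta> \<in> {1, -1}" using assms by auto
  have s: "op23 (piA b) (VA b) (TA_ell L \<tau> r) (first_back a \<eta> \<eta>) =
      cscale (?t (- \<eta>) (- \<eta>)) (first_back a \<eta> \<eta>) + cscale (?t \<eta> (- \<eta>)) (last_back a \<eta> \<eta>)"
    using op23_last_back[OF assms(1,2) m, of L \<tau> r] assms(2) by (auto simp: add.commute)
  show ?thesis
    unfolding True s complex_linear_add[OF lin] complex_linear_cscale[OF lin]
      op12_straight[OF assms(2)]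
    by simp
next
  case False
  then have "\<eta> = - \<epsilon>" using assms by auto
  then show ?thesis
    using op23_straight[OF assms(1,3), of "- \<epsilon>" L \<tau> r] assms(3) False
    by (auto simp: complex_linear_zero[OF complex_linear_op12])
qed

text \<open>The mirror image: for \<open>\<epsilon> = -\<eta>\<close> the off-diagonal term is the path \<open>(-\<eta>, \<eta>, \<eta>)\<close>, killed by the
  operator on the last two steps.\<close>

lemma op23_op12_last_back:
  assumes "a \<in> shifted_ints b" "\<eta> \<in> {1, -1}" "\<epsilon> \<in> {1, -1}"
  shows "op23 (piA b) (VA b) (TA_ell L \<tau> r) (op12 (TA_ell L \<tau> r) a (last_back a \<eta> \<epsilon>)) =
    (if \<epsilon> = - \<eta> then cscale (backtrack_coeff L \<tau> r a \<eta> \<eta>)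
       (op23 (piA b) (VA b) (TA_ell L \<tau> r) (last_back a \<eta> (- \<eta>))) else 0)"
proof (cases "\<epsilon> = - \<eta>")
  case True
  note lin = complex_linear_op23[of "piA b" "VA b" "TA_ell L \<tau> r"]
  let ?t = "backtrack_coeff L \<tau> r a"
  have m: "- \<eta> \<in> {1, -1}" using assms by auto
  have z: "op23 (piA b) (VA b) (TA_ell L \<tau> r) (first_back a \<eta> (- \<eta>)) = 0"
    using op23_straight[OF assms(1) m assms(2), of L \<tau> r] by simp
  have s: "op12 (TA_ell L \<tau> r) a (last_back a \<eta> (- \<eta>)) =
      cscale (?t \<eta> \<eta>) (last_back a \<eta> (- \<eta>)) + cscale (?t (- \<eta>) \<eta>) (first_back a \<eta> (- \<eta>))"
    using op12_first_back[OF assms(2), of L \<tau> r a \<eta>] assms(2) by (auto simp: add.commute)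
  show ?thesis
    unfolding True s complex_linear_add[OF lin] complex_linear_cscale[OF lin] z
    by simp
next
  case False
  then have "\<epsilon> = \<eta>" using assms by auto
  then show ?thesis
    using op12_straight[OF assms(2), of L \<tau> r a] False
    by (simp add: complex_linear_zero[OF complex_linear_op23])
qed

text \<open>Only the intermediate state \<open>\<mu> = \<eta>\<close> survives the middle factor, with weight
  \<open>t\<^bsub>-\<eta>,-\<eta>\<^esub>(a + \<eta>)\<close>; the exchange rule then splits off \<open>t\<^bsub>\<eta>\<eta>\<^esub>(a)\<close>, which cancels this weight.\<close>

lemma op12_op23_op12:
  assumes a: "a \<in> shifted_ints b"
    and bracket: "\<And>a. a \<in> shifted_ints b \<Longrightarrow> ell_bracket L \<tau> a \<noteq> 0"
    and root: "\<And>a. a \<in> shifted_ints b \<Longrightarrow> (r a)\<^sup>2 = ell_bracket L \<tau> (a - 1) * ell_bracket L \<tau> (a + 1)"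
    and p: "p \<in> source_fiber (piA b) (tensor (piA b) (VA b) (tensor (piA b) (VA b) (VA b))) a"
  shows "op12 (TA_ell L \<tau> r) a (op23 (piA b) (VA b) (TA_ell L \<tau> r) (op12 (TA_ell L \<tau> r) a p)) =
    op12 (TA_ell L \<tau> r) a p"
proof (rule complex_linear_eqI[where
      f = "\<lambda>p. op12 (TA_ell L \<tau> r) a (op23 (piA b) (VA b) (TA_ell L \<tau> r) (op12 (TA_ell L \<tau> r) a p))" and
      g = "op12 (TA_ell L \<tau> r) a"])
  let ?A = "op12 (TA_ell L \<tau> r) a" and ?B = "op23 (piA b) (VA b) (TA_ell L \<tau> r)"
  let ?t = "backtrack_coeff L \<tau> r a"
  note lin = complex_linear_op12[of "TA_ell L \<tau> r" a] complex_linear_op23[of "piA b" "VA b" "TA_ell L \<tau> r"]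
  show "complex_linear (\<lambda>p. ?A (?B (?A p)))" "complex_linear ?A"
    by (rule complex_linear_compose[OF lin(1) complex_linear_compose[OF lin(2,1)]], rule lin(1))
  note linAB = complex_linear_compose[OF lin]
  fix i assume "i \<in> Poly_Mapping.keys p"
  with p obtain \<epsilon> \<epsilon>' \<eta> where e: "\<epsilon> \<in> {1, -1}" "\<epsilon>' \<in> {1, -1}" "\<eta> \<in> {1, -1}"
    "i = ((a, \<epsilon>), (a + of_int \<epsilon>, \<epsilon>'), (a + of_int \<epsilon> + of_int \<epsilon>', \<eta>))"
    by (rule source_fiber_three_steps)
  show "?A (?B (?A (unit_vec i))) = ?A (unit_vec i)"
  proof (cases "\<epsilon>' = \<epsilon>")
    case True
    then show ?thesis
      using e op12_straight[OF e(1)] complex_linear_zero[OF linAB] by simp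
  next
    case False
    then have "\<epsilon>' = - \<epsilon>" using e by auto
    then have i: "unit_vec i = first_back a \<eta> \<epsilon>" using e by simp
    let ?c = "backtrack_coeff L \<tau> r (a + of_int \<eta>) (- \<eta>) (- \<eta>)"
    have recip: "?c * ?t \<eta> \<eta> = 1"
      using backtrack_coeff_diag_reciprocal[of L \<tau> a \<eta> r] bracket a shifted_ints_step[OF a]
      by (simp add: mult.commute)
    have coeff: "?t \<eta> \<epsilon> * (?c * ?t \<delta> \<eta>) = ?t \<delta> \<epsilon>" if "\<delta> \<in> {1, -1}" for \<delta>
    proof -
      have "?t \<eta> \<epsilon> * (?c * ?t \<delta> \<eta>) = ?c * (?t \<delta> \<eta> * ?t \<eta> \<epsilon>)" by simp
      also have "\<dots> = ?t \<delta> \<epsilon>"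
        unfolding backtrack_coeff_exchange[of r _ L \<tau>, OF root[OF a] that e(1,3)]
        using recip by (simp flip: mult.assoc)
      finally show ?thesis .
    qed
    have "?A (?B (?A (first_back a \<eta> \<epsilon>)))
        = (\<Sum>\<mu>\<in>{1, -1}. cscale (?t \<mu> \<epsilon>) (?A (?B (first_back a \<eta> \<mu>))))"
      unfolding op12_first_back[OF e(1)] complex_linear_sum[OF linAB] complex_linear_cscale[OF linAB] ..
    also have "\<dots> = (\<Sum>\<mu>\<in>{1, -1}. if \<mu> = \<eta> then cscale (?t \<eta> \<epsilon> * ?c) (?A (first_back a \<eta> \<eta>)) else 0)"
      by (intro sum.cong refl) (simp add: op12_op23_first_back[OF a e(3)])
    also have "\<dots> = cscale (?t \<eta> \<epsilon> * ?c) (?A (first_back a \<eta> \<eta>))"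
      using e(3) by auto
    also have "\<dots> = ?A (first_back a \<eta> \<epsilon>)"
      unfolding op12_first_back[OF e(1)] op12_first_back[OF e(3)] cscale_sum cscale_cscale mult.assoc
      by (intro sum.cong refl) (simp only: coeff)
    finally show ?thesis unfolding i .
  qed
qed

text \<open>Here the surviving intermediate state is \<open>\<mu> = -\<eta>\<close>, and the exchange rule is applied at the vertex
  \<open>a + \<eta>\<close> where the last two steps start.\<close>

lemma op23_op12_op23:
  assumes a: "a \<in> shifted_ints b"
    and bracket: "\<And>a. a \<in> shifted_ints b \<Longrightarrow> ell_bracket L \<tau> a \<noteq> 0"
    and root: "\<And>a. a \<in> shifted_ints b \<Longrightarrow> (r a)\<^sup>2 = ell_bracket L \<tau> (a - 1) * ell_bracket L \<tau> (a + 1)"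
    and p: "p \<in> source_fiber (piA b) (tensor (piA b) (VA b) (tensor (piA b) (VA b) (VA b))) a"
  shows "op23 (piA b) (VA b) (TA_ell L \<tau> r) (op12 (TA_ell L \<tau> r) a
      (op23 (piA b) (VA b) (TA_ell L \<tau> r) p)) = op23 (piA b) (VA b) (TA_ell L \<tau> r) p"
proof (rule complex_linear_eqI[where
      f = "\<lambda>p. op23 (piA b) (VA b) (TA_ell L \<tau> r) (op12 (TA_ell L \<tau> r) a (op23 (piA b) (VA b) (TA_ell L \<tau> r) p))" and
      g = "op23 (piA b) (VA b) (TA_ell L \<tau> r)"])
  let ?A = "op12 (TA_ell L \<tau> r) a" and ?B = "op23 (piA b) (VA b) (TA_ell L \<tau> r)"
  note lin = complex_linear_op23[of "piA b" "VA b" "TA_ell L \<tau> r"] complex_linear_op12[of "TA_ell L \<tau> r" a]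
  show "complex_linear (\<lambda>p. ?B (?A (?B p)))" "complex_linear ?B"
    by (rule complex_linear_compose[OF lin(1) complex_linear_compose[OF lin(2,1)]], rule lin(1))
  note linBA = complex_linear_compose[OF lin]
  fix i assume "i \<in> Poly_Mapping.keys p"
  with p obtain \<eta> \<epsilon> \<epsilon>' where e: "\<eta> \<in> {1, -1}" "\<epsilon> \<in> {1, -1}" "\<epsilon>' \<in> {1, -1}"
    "i = ((a, \<eta>), (a + of_int \<eta>, \<epsilon>), (a + of_int \<eta> + of_int \<epsilon>, \<epsilon>'))"
    by (rule source_fiber_three_steps)
  let ?t = "backtrack_coeff L \<tau> r (a + of_int \<eta>)"
  show "?B (?A (?B (unit_vec i))) = ?B (unit_vec i)"
  proof (cases "\<epsilon>' = \<epsilon>")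
    case True
    then show ?thesis
      using e op23_straight[OF a e(1,2)] complex_linear_zero[OF linBA] by simp
  next
    case False
    then have "\<epsilon>' = - \<epsilon>" using e by auto
    then have i: "unit_vec i = last_back a \<eta> \<epsilon>" using e by simp
    let ?c = "backtrack_coeff L \<tau> r a \<eta> \<eta>"
    have m: "- \<eta> \<in> {1, -1}" using e by auto
    have recip: "?c * ?t (- \<eta>) (- \<eta>) = 1"
      using backtrack_coeff_diag_reciprocal[of L \<tau> a \<eta> r] bracket a shifted_ints_step[OF a]
      by simp
    have coeff: "?t (- \<eta>) \<epsilon> * (?c * ?t \<delta> (- \<eta>)) = ?t \<delta> \<epsilon>" if "\<delta> \<in> {1, -1}" for \<delta>
    proof -
      have "?t (- \<eta>) \<epsilon> * (?c * ?t \<delta> (- \<eta>)) = ?c * (?t \<delta> (- \<eta>) * ?t (- \<eta>) \<epsilon>)" by simp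
      also have "\<dots> = ?t \<delta> \<epsilon>"
        unfolding backtrack_coeff_exchange[of r _ L \<tau>, OF root[OF shifted_ints_step[OF a, of \<eta>]] that e(2) m]
        using recip by (simp flip: mult.assoc)
      finally show ?thesis .
    qed
    have "?B (?A (?B (last_back a \<eta> \<epsilon>)))
        = (\<Sum>\<mu>\<in>{1, -1}. cscale (?t \<mu> \<epsilon>) (?B (?A (last_back a \<eta> \<mu>))))"
      unfolding op23_last_back[OF a e(1,2)] complex_linear_sum[OF linBA] complex_linear_cscale[OF linBA] ..
    also have "\<dots> = (\<Sum>\<mu>\<in>{1, -1}. if \<mu> = - \<eta> then cscale (?t (- \<eta>) \<epsilon> * ?c) (?B (last_back a \<eta> (- \<eta>))) else 0)"
      by (intro sum.cong refl) (simp add: op23_op12_last_back[OF a e(1)])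
    also have "\<dots> = cscale (?t (- \<eta>) \<epsilon> * ?c) (?B (last_back a \<eta> (- \<eta>)))"
      using e(1) by auto
    also have "\<dots> = ?B (last_back a \<eta> \<epsilon>)"
      unfolding op23_last_back[OF a e(1,2)] op23_last_back[OF a e(1) m] cscale_sum cscale_cscale mult.assoc
      by (intro sum.cong refl) (simp only: coeff)
    finally show ?thesis unfolding i .
  qed
qed

theorem proposition2p30:
  fixes \<tau> b :: complex and L :: nat and r :: "complex \<Rightarrow> complex"
  assumes "Im \<tau> > 0"
    and "L \<ge> 2"
    and "1 / (of_nat L + 1) \<notin> {of_int m + \<tau> * of_int n |m n. True}"
    and generic: "\<And>a. a \<in> shifted_ints b \<Longrightarrow> ell_bracket L \<tau> a \<noteq> 0 \<and> kappa_ell L \<tau> a \<noteq> 0"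
    and square_root: "\<And>a. a \<in> shifted_ints b \<Longrightarrow>
          (r a)\<^sup>2 = ell_bracket L \<tau> (a - 1) * ell_bracket L \<tau> (a + 1)"
  shows "local_dynamical_TL (piA b) (VA b) (kappa_ell L \<tau>) (TA_ell L \<tau> r)"
proof -
  have Ob: "Ob (piA b) = shifted_ints b"
    by (simp add: piA_def graph_groupoid_def)
  show ?thesis
    unfolding local_dynamical_TL_def Ob
  proof (intro conjI ballI)
    fix a assume a: "a \<in> shifted_ints b"
    show "kappa_ell L \<tau> a \<noteq> 0" using generic a by blast
    show "TA_ell L \<tau> r a \<in> fiber_End (piA b) (tensor (piA b) (VA b) (VA b)) a"
      by (rule TA_ell_in_fiber_End[OF a])
  qed (use generic square_root in
      \<open>auto intro!: TA_ell_idempotent_up_to_kappa op12_op23_op12 op23_op12_op23\<close>)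
qed

end
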